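(* Let $\Omega\subset\mathbb{R}^n$ be open and connected, let $F\in C^1(\Omega,\mathbb{R}^n)$, and let $\phi(t,z)$ be the local flow on $\Omega$ defined by the differential system $\dot z=F(z)$. Let $\Delta_0=\{z\in\Omega:\operatorname{div}F(z)=0\}$. Let $\sigma\in C^1(\Omega,\Omega)$ be a measure-preserving reversibility of $\dot z=F(z)$. Then: (i) if there exist $z\in\Omega$ and $t_z\in\mathbb{R}$ such that $\sigma(z)=\phi(t_z,z)\neq z$, then the arc of orbit $\gamma_z=\{\phi(t,z): t \text{ between } 0 \text{ and } t_z\}$ (endpoints included) connecting $z$ to $\sigma(z)$ contains a point $z_0\in\Delta_0$; (ii) if $z\in\Omega$ is a regular $\sigma$-fixed point, i.e. $\sigma(z)=z$ and $F(z)\neq 0$, then $z\in\Delta_0$.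
   Context: An involution of $\Omega$ is a $C^1$ diffeomorphism $\sigma$ of $\Omega$ onto itself with $\sigma(\sigma(z))=z$ for all $z\in\Omega$. An involution $\sigma$ is a reversibility of the system $\dot z=F(z)$ if $\phi(t,\sigma(z))=\sigma(\phi(-t,z))$ for all $t\in\mathbb{R}$ and $z\in\Omega$ such that both sides are defined. The map $\sigma$ is measure-preserving if $\mu(\sigma(A))=\mu(A)$ for every measurable $A\subset\Omega$, where $\mu$ is Lebesgue measure. Here $\operatorname{div}F=\sum_{i=1}^n\partial F_i/\partial z_i$. *)

theory Defs
  imports "HOL-Analysis.Analysis"
begin

definition C1_on :: "(real ^ 'n) set \<Rightarrow> (real ^ 'n \<Rightarrow> real ^ 'n) \<Rightarrow> bool" where
  "C1_on \<Omega> f \<longleftrightarrow>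
     (\<exists>f' :: real ^ 'n \<Rightarrow> (real ^ 'n) \<Rightarrow>\<^sub>L (real ^ 'n).
        (\<forall>z\<in>\<Omega>. (f has_derivative blinfun_apply (f' z)) (at z)) \<and> continuous_on \<Omega> f')"

definition C1_diffeo_onto_itself :: "(real ^ 'n) set \<Rightarrow> (real ^ 'n \<Rightarrow> real ^ 'n) \<Rightarrow> bool" where
  "C1_diffeo_onto_itself \<Omega> f \<longleftrightarrow>
     bij_betw f \<Omega> \<Omega> \<and> C1_on \<Omega> f \<and> C1_on \<Omega> (inv_into \<Omega> f)"

definition divergence :: "(real ^ 'n \<Rightarrow> real ^ 'n) \<Rightarrow> real ^ 'n \<Rightarrow> real" where
  "divergence F z = (\<Sum>i\<in>UNIV. deriv (\<lambda>s. F (z + s *\<^sub>R axis i 1) $ i) 0)"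

definition is_solution ::
    "(real ^ 'n \<Rightarrow> real ^ 'n) \<Rightarrow> (real ^ 'n) set \<Rightarrow> real ^ 'n \<Rightarrow> real set \<Rightarrow> (real \<Rightarrow> real ^ 'n) \<Rightarrow> bool"
where
  "is_solution F \<Omega> z J x \<longleftrightarrow>
     open J \<and> is_interval J \<and> 0 \<in> J \<and> x 0 = z \<and>
     (\<forall>t\<in>J. x t \<in> \<Omega> \<and> (x has_vector_derivative F (x t)) (at t))"

text \<open>The maximal interval of existence of the solution of \<open>z' = F z\<close> in \<open>\<Omega>\<close> starting at
  \<open>z\<close>, and the local flow. For \<open>F\<close> of class \<open>C\<^sup>1\<close> on an open \<open>\<Omega>\<close>, solutions are unique, so the
  description below is proper for \<open>t \<in> flow_dom F \<Omega> z\<close>; for other \<open>t\<close> the flow is undefined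
  and the value of \<open>flow\<close> carries no meaning.\<close>

definition flow_dom :: "(real ^ 'n \<Rightarrow> real ^ 'n) \<Rightarrow> (real ^ 'n) set \<Rightarrow> real ^ 'n \<Rightarrow> real set" where
  "flow_dom F \<Omega> z = \<Union>{J. \<exists>x. is_solution F \<Omega> z J x}"

definition flow ::
    "(real ^ 'n \<Rightarrow> real ^ 'n) \<Rightarrow> (real ^ 'n) set \<Rightarrow> real \<Rightarrow> real ^ 'n \<Rightarrow> real ^ 'n" where
  "flow F \<Omega> t z = (THE y. \<exists>J x. is_solution F \<Omega> z J x \<and> t \<in> J \<and> x t = y)"

definition is_involution :: "(real ^ 'n) set \<Rightarrow> (real ^ 'n \<Rightarrow> real ^ 'n) \<Rightarrow> bool" where
  "is_involution \<Omega> \<sigma> \<longleftrightarrow> C1_diffeo_onto_itself \<Omega> \<sigma> \<and> (\<forall>z\<in>\<Omega>. \<sigma> (\<sigma> z) = z)"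

definition is_reversibility ::
    "(real ^ 'n \<Rightarrow> real ^ 'n) \<Rightarrow> (real ^ 'n) set \<Rightarrow> (real ^ 'n \<Rightarrow> real ^ 'n) \<Rightarrow> bool" where
  "is_reversibility F \<Omega> \<sigma> \<longleftrightarrow> is_involution \<Omega> \<sigma> \<and>
     (\<forall>z\<in>\<Omega>. \<forall>t. t \<in> flow_dom F \<Omega> (\<sigma> z) \<and> - t \<in> flow_dom F \<Omega> z \<longrightarrow>
        flow F \<Omega> t (\<sigma> z) = \<sigma> (flow F \<Omega> (- t) z))"

definition measure_preserving_on :: "(real ^ 'n) set \<Rightarrow> (real ^ 'n \<Rightarrow> real ^ 'n) \<Rightarrow> bool" where
  "measure_preserving_on \<Omega> \<sigma> \<longleftrightarrow>
     (\<forall>A\<in>sets lebesgue. A \<subseteq> \<Omega> \<longrightarrow> emeasure lebesgue (\<sigma> ` A) = emeasure lebesgue A)"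

definition zero_div_set :: "(real ^ 'n \<Rightarrow> real ^ 'n) \<Rightarrow> (real ^ 'n) set \<Rightarrow> (real ^ 'n) set" where
  "zero_div_set F \<Omega> = {z \<in> \<Omega>. divergence F z = 0}"

definition orbit_arc ::
    "(real ^ 'n \<Rightarrow> real ^ 'n) \<Rightarrow> (real ^ 'n) set \<Rightarrow> real ^ 'n \<Rightarrow> real \<Rightarrow> (real ^ 'n) set" where
  "orbit_arc F \<Omega> z T = (\<lambda>t. flow F \<Omega> t z) ` closed_segment 0 T"

end

theory Submission
  imports Defs
begin

text \<open>Differentiating the reversibility relation at \<open>t = 0\<close> gives \<open>F \<circ> \<sigma> = - D\<sigma> F\<close>. Since \<open>\<sigma>\<close> is only
  \<open>C\<^sup>1\<close>, this cannot be differentiated again; but testing the divergence against bump functions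
  \<open>\<eta>\<close> and \<open>\<eta> \<circ> \<sigma>\<close>, and substituting \<open>\<sigma>\<close> in the integrals, which preserves measure, shows in the
  weak sense, and hence pointwise, that \<open>div F \<circ> \<sigma> = - div F\<close>. So the divergence vanishes at the
  fixed points of \<open>\<sigma>\<close>, and it takes opposite values at the ends of an arc from \<open>z\<close> to \<open>\<sigma> z\<close>.\<close>

section \<open>Local Lipschitz bounds and the mean value inequality\<close>

lemma C1_on_local_lipschitz:
  fixes F :: "real ^ 'n \<Rightarrow> real ^ 'n"
  assumes "open \<Omega>" "C1_on \<Omega> F" "p \<in> \<Omega>"
  obtains r L where "0 < r" "cball p r \<subseteq> \<Omega>" "L-lipschitz_on (cball p r) F"
proof -
  obtain F' where F': "\<And>z. z \<in> \<Omega> \<Longrightarrow> (F has_derivative blinfun_apply (F' z)) (at z)"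
    and cF': "continuous_on \<Omega> F'"
    using assms(2) C1_on_def by metis
  obtain r where r: "0 < r" "cball p r \<subseteq> \<Omega>"
    using open_contains_cball_eq[OF assms(1)] assms(3) by blast
  \<comment> \<open>Compactness of the ball bounds the continuous derivative, and convexity turns
    that bound into a Lipschitz constant.\<close>
  have "compact (F' ` cball p r)"
    by (rule compact_continuous_image[OF continuous_on_subset[OF cF' r(2)] compact_cball])
  then obtain L where "\<forall>y\<in>F' ` cball p r. norm y \<le> L"
    using compact_imp_bounded bounded_iff by metis
  then have L: "norm (F' x) \<le> L" if "x \<in> cball p r" for x
    using that by blast
  have "0 \<le> norm (F' p)" by simp
  also have "\<dots> \<le> L" by (rule L) (use r(1) in simp)
  finally have "0 \<le> L" .
  have "norm (F x - F y) \<le> L * norm (x - y)"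
    if "x \<in> cball p r" "y \<in> cball p r" for x y
  proof (rule differentiable_bound[OF convex_cball _ _ that, of F "\<lambda>z. blinfun_apply (F' z)"])
    fix z assume z: "z \<in> cball p r"
    show "(F has_derivative blinfun_apply (F' z)) (at z within cball p r)"
      by (rule has_derivative_at_withinI[OF F']) (use r z in blast)
    show "onorm (blinfun_apply (F' z)) \<le> L"
      using L[OF z] by (simp add: norm_blinfun.rep_eq)
  qed
  with \<open>0 \<le> L\<close> have "L-lipschitz_on (cball p r) F"
    by (intro lipschitz_onI) (auto simp: dist_norm)
  from that[OF r this] show thesis .
qed

text \<open>The mean value inequality for curves. Since the derivatives are taken within
  \<open>S\<close>, closed time intervals are covered with one-sided derivatives at their
  ends.\<close>

lemma vector_derivative_bound:
  fixes f :: "real \<Rightarrow> 'a::real_normed_vector"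
  assumes "convex S" "s \<in> S" "t \<in> S"
    and "\<And>u. u \<in> S \<Longrightarrow> (f has_vector_derivative f' u) (at u within S)"
    and "\<And>u. u \<in> S \<Longrightarrow> norm (f' u) \<le> B"
  shows "norm (f t - f s) \<le> B * \<bar>t - s\<bar>"
proof -
  have "onorm (\<lambda>x. x *\<^sub>R f' u) \<le> B" if "u \<in> S" for u
  proof (rule onorm_le)
    fix x :: real
    show "norm (x *\<^sub>R f' u) \<le> B * norm x"
      using mult_right_mono[OF assms(5)[OF that], of "\<bar>x\<bar>"] by (simp add: mult.commute)
  qed
  then show ?thesis
    using differentiable_bound[OF assms(1), of f "\<lambda>u x. x *\<^sub>R f' u" B t s] assms
    by (auto simp: has_vector_derivative_def)
qed

subsection \<open>Existence and uniqueness of solutions\<close>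

text \<open>Picard iteration: on the time interval from \<open>-h\<close> to \<open>h\<close> the
  integral operator contracts with factor \<open>L * h\<close>. As \<open>G\<close> is Lipschitz on
  the whole space, the operator acts on all bounded continuous curves, and Banach's theorem gives a
  fixed point.\<close>

lemma picard_lindeloef_global:
  fixes G :: "'a::euclidean_space \<Rightarrow> 'a"
  assumes G: "L-lipschitz_on UNIV G" and h: "0 < h" "L * h < 1"
  shows "\<exists>x. x 0 = z \<and> (\<forall>t\<in>{-h<..<h}. (x has_vector_derivative G (x t)) (at t))"
proof -
  \<comment> \<open>The type of bounded continuous functions has the whole line as domain. Clamping
    time with \<open>c\<close> freezes the Picard integral outside \<open>{-h..h}\<close> and so
    keeps it bounded.\<close>
  define c where "c t = max (- h) (min h t)" for t :: real
  have c: "c t \<in> {-h..h}" for t using h by (auto simp: c_def)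
  have contc: "continuous_on UNIV c" unfolding c_def by (intro continuous_intros)
  \<comment> \<open>Integrating from \<open>-h\<close> avoids signed integrals for negative times;
    subtracting \<open>I x 0\<close> in \<open>T\<close> restores the initial value
    \<open>z\<close>.\<close>
  define I where "I x t = integral {-h..t} (\<lambda>s. G (x s))" for x :: "real \<Rightarrow> 'a" and t
  have contG: "continuous_on UNIV G" using G by (rule lipschitz_on_continuous_on)
  have dI: "(I x has_vector_derivative G (x t)) (at t within {-h..h})"
    if "continuous_on UNIV x" "t \<in> {-h..h}" for x t
    unfolding I_def
    by (rule integral_has_vector_derivative[OF _ that(2)])
      (intro continuous_on_compose2[OF contG] continuous_on_subset[OF that(1)], auto)
  define T where "T x t = z + (I x (c t) - I x 0)" for x :: "real \<Rightarrow> 'a" and t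
  have T: "T x \<in> bcontfun" if x: "continuous_on UNIV x" for x
  proof -
    have cI: "continuous_on {-h..h} (I x)"
      using dI[OF x] has_vector_derivative_continuous continuous_on_eq_continuous_within by blast
    then have "bounded (I x ` {-h..h})"
      by (intro compact_imp_bounded compact_continuous_image) auto
    then obtain B where B: "\<And>t. t \<in> {-h..h} \<Longrightarrow> norm (I x t) \<le> B"
      by (metis bounded_iff imageI)
    show ?thesis
    proof (rule bcontfun_normI)
      show "continuous_on UNIV (T x)"
        unfolding T_def by (intro continuous_intros continuous_on_compose2[OF cI contc]) (use c in auto)
      show "norm (T x t) \<le> norm z + (B + norm (I x 0))" for t
        unfolding T_def
        by (intro norm_triangle_mono norm_triangle_le_diff add_mono B c order_refl)
    qed
  qed
  have L0: "0 \<le> L" using G by (rule lipschitz_on_nonneg)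
  define TT where "TT x = Bcontfun (T (apply_bcontfun x))" for x
  have TT: "apply_bcontfun (TT x) = T (apply_bcontfun x)" for x
    unfolding TT_def by (rule Bcontfun_inverse) (intro T continuous_on_apply_bcontfun)
  have "dist (TT x) (TT y) \<le> (L * h) * dist x y" for x y
  proof (rule dist_bound)
    fix t
    let ?W = "\<lambda>t. I x t - I y t"
    have "norm (?W (c t) - ?W 0) \<le> (L * dist x y) * \<bar>c t - 0\<bar>"
    proof (rule vector_derivative_bound[where S = "{-h..h}" and f' = "\<lambda>t. G (x t) - G (y t)"])
      fix u assume u: "u \<in> {-h..h}"
      show "(?W has_vector_derivative G (x u) - G (y u)) (at u within {-h..h})"
        by (intro has_vector_derivative_diff dI u continuous_on_apply_bcontfun)
      have "dist (G (x u)) (G (y u)) \<le> L * dist (x u) (y u)"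
        using G by (rule lipschitz_onD) auto
      also have "\<dots> \<le> L * dist x y" by (intro mult_left_mono dist_bounded L0)
      finally show "norm (G (x u) - G (y u)) \<le> L * dist x y" by (simp add: dist_norm)
    qed (use c h in auto)
    also have "\<dots> \<le> (L * dist x y) * h"
      using c[of t] L0 by (intro mult_left_mono) auto
    finally show "dist (TT x t) (TT y t) \<le> (L * h) * dist x y"
      unfolding TT T_def by (simp add: dist_norm algebra_simps)
  qed
  then obtain x where x: "TT x = x"
    using banach_fix_type[of "L * h" TT] L0 h by auto
  have xt: "x t = z + (I x (c t) - I x 0)" for t
    using arg_cong[OF x, of "\<lambda>y. apply_bcontfun y t"] unfolding TT T_def by simp
  have "(x has_vector_derivative G (x t)) (at t)" if t: "t \<in> {-h<..<h}" for t
  proof -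
    \<comment> \<open>Strictly between \<open>-h\<close> and \<open>h\<close> the clamp is the
      identity, so the fixed point equation is the integral equation and can be
      differentiated.\<close>
    have "((\<lambda>t. z + (I x t - I x 0)) has_vector_derivative G (x t)) (at t within {-h<..<h})"
      using t by (auto intro!: derivative_eq_intros
          has_vector_derivative_within_subset[OF dI[OF continuous_on_apply_bcontfun]])
    then have "(x has_vector_derivative G (x t)) (at t within {-h<..<h})"
      by (rule has_vector_derivative_transform[OF t, rotated]) (auto simp: xt c_def)
    then show ?thesis
      using at_within_open[OF t open_greaterThanLessThan] by simp
  qed
  moreover have "x 0 = z" using h by (simp add: xt c_def)
  ultimately show ?thesis by blast
qed

text \<open>Composing \<open>F\<close> with the nearest-point projection \<open>P\<close> onto a
  small ball makes it globally Lipschitz, because \<open>P\<close> does not increase distances. The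
  solution for \<open>F\<close> composed with \<open>P\<close> moves with speed at most
  \<open>M\<close>; for short times it stays in the ball, where \<open>P\<close> is the identity,
  and hence solves the original system.\<close>

lemma ex_solution:
  fixes F :: "real ^ 'n \<Rightarrow> real ^ 'n"
  assumes "open \<Omega>" "C1_on \<Omega> F" "p \<in> \<Omega>"
  shows "\<exists>J x. is_solution F \<Omega> p J x"
proof -
  obtain r L where r: "0 < r" "cball p r \<subseteq> \<Omega>" and L: "L-lipschitz_on (cball p r) F"
    using C1_on_local_lipschitz[OF assms] .
  have L0: "0 \<le> L" using L by (rule lipschitz_on_nonneg)
  define P where "P = closest_point (cball p r)"
  have P: "P x \<in> cball p r" for x
    using r unfolding P_def by (intro closest_point_in_set) auto
  have "L-lipschitz_on UNIV (\<lambda>x. F (P x))"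
  proof (rule lipschitz_onI[OF _ L0])
    fix x y
    have "dist (F (P x)) (F (P y)) \<le> L * dist (P x) (P y)"
      using L P P by (rule lipschitz_onD)
    also have "\<dots> \<le> L * dist x y"
      unfolding P_def using r L0 by (intro mult_left_mono closest_point_lipschitz) auto
    finally show "dist (F (P x)) (F (P y)) \<le> L * dist x y" .
  qed
  moreover
  have "bounded (F ` cball p r)"
    by (intro compact_imp_bounded compact_continuous_image lipschitz_on_continuous_on[OF L]) auto
  then obtain M where M: "\<And>x. norm (F (P x)) \<le> M"
    using P by (force simp: bounded_iff)
  have M0: "0 \<le> M" using M[of p] norm_ge_zero order_trans by blast
  \<comment> \<open>The first bound makes the Picard operator contract, the second keeps the
    solution in the ball. Adding 1 keeps the denominators positive and makes both inequalities
    strict.\<close>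
  define h where "h = min (1 / (L + 1)) (r / (M + 1))"
  have h: "0 < h" "L * h < 1" "M * h < r"
  proof -
    show "0 < h" using L0 M0 r by (auto simp: h_def)
    have "L * h \<le> L * (1 / (L + 1))" using L0 by (intro mult_left_mono) (auto simp: h_def)
    also have "\<dots> < 1" using L0 by (simp add: field_simps)
    finally show "L * h < 1" .
    have "M * h \<le> M * (r / (M + 1))" using M0 by (intro mult_left_mono) (auto simp: h_def)
    also have "\<dots> < r" using M0 r by (simp add: field_simps)
    finally show "M * h < r" .
  qed
  ultimately obtain x where x: "x 0 = p"
    "\<And>t. t \<in> {-h<..<h} \<Longrightarrow> (x has_vector_derivative F (P (x t))) (at t)"
    using picard_lindeloef_global by blast
  have inball: "x t \<in> cball p r" if t: "t \<in> {-h<..<h}" for t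
  proof -
    have "norm (x t - x 0) \<le> M * \<bar>t - 0\<bar>"
      by (rule vector_derivative_bound[where S = "{-h<..<h}" and f' = "\<lambda>t. F (P (x t))"])
        (use h t M in \<open>auto intro!: has_vector_derivative_at_within[OF x(2)]\<close>)
    also have "\<dots> \<le> M * h" using t M0 by (intro mult_left_mono) auto
    finally show ?thesis using h by (simp add: dist_norm x norm_minus_commute)
  qed
  then have "P (x t) = x t" if "t \<in> {-h<..<h}" for t
    unfolding P_def using that by (intro closest_point_self) auto
  then have "is_solution F \<Omega> p {-h<..<h} x"
    using x inball r h unfolding is_solution_def by (auto simp: is_interval_convex_1)
  then show ?thesis by blast
qed

text \<open>The set of times at which the solutions agree contains 0 and is both closed and open in
  the connected common domain.\<close>

lemma solution_unique:
  fixes F :: "real ^ 'n \<Rightarrow> real ^ 'n"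
  assumes \<Omega>: "open \<Omega>" "C1_on \<Omega> F"
    and x: "is_solution F \<Omega> z J1 x" and y: "is_solution F \<Omega> z J2 y"
    and t: "t \<in> J1" "t \<in> J2"
  shows "x t = y t"
proof -
  define J where "J = J1 \<inter> J2"
  have J: "open J" "connected J" "0 \<in> J"
    using x y unfolding J_def is_solution_def
    by (auto simp: is_interval_connected_1[symmetric] is_interval_Int)
  have dx: "(x has_vector_derivative F (x t)) (at t)" "x t \<in> \<Omega>" 
    and dy: "(y has_vector_derivative F (y t)) (at t)" "y t \<in> \<Omega>" if "t \<in> J" for t
    using x y that unfolding J_def is_solution_def by auto
  have cx: "continuous_on J x" and cy: "continuous_on J y"
    using dx dy J by (auto simp: continuous_on_eq_continuous_at intro: has_vector_derivative_continuous)
  define S where "S = {t \<in> J. x t = y t}"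
  have "closedin (top_of_set J) S"
    unfolding S_def using continuous_closedin_preimage_constant[of J "\<lambda>t. x t - y t" 0] cx cy
    by (simp add: continuous_on_diff)
  moreover have "openin (top_of_set J) S"
  proof -
    have "\<exists>h>0. ball t0 h \<subseteq> S" if t0: "t0 \<in> S" for t0
    proof -
      have t0J: "t0 \<in> J" and eq: "x t0 = y t0" using t0 by (auto simp: S_def)
      obtain r L where r: "0 < r" "cball (x t0) r \<subseteq> \<Omega>" and L: "L-lipschitz_on (cball (x t0) r) F"
        using C1_on_local_lipschitz[OF \<Omega> dx(2)[OF t0J]] .
      have L0: "0 \<le> L" using L by (rule lipschitz_on_nonneg)
      have "open (J \<inter> x -` ball (x t0) r)" "open (J \<inter> y -` ball (x t0) r)"
        using J cx cy by (auto intro: continuous_open_preimage)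
      then have "open ((J \<inter> x -` ball (x t0) r) \<inter> (J \<inter> y -` ball (x t0) r))" by (rule open_Int)
      moreover have "t0 \<in> (J \<inter> x -` ball (x t0) r) \<inter> (J \<inter> y -` ball (x t0) r)"
        using t0J r eq by auto
      ultimately obtain e where e: "0 < e"
        "cball t0 e \<subseteq> (J \<inter> x -` ball (x t0) r) \<inter> (J \<inter> y -` ball (x t0) r)"
        using open_contains_cball by metis
      define h where "h = min e (1 / (L + 1))"
      have h: "0 < h" "h \<le> e" using e L0 by (auto simp: h_def)
      have "L * h \<le> L * (1 / (L + 1))" using L0 by (intro mult_left_mono) (auto simp: h_def)
      also have "\<dots> < 1" using L0 by (simp add: field_simps)
      finally have Lh: "L * h < 1" .
      have sub: "s \<in> J" "x s \<in> cball (x t0) r" "y s \<in> cball (x t0) r" if "s \<in> cball t0 h" for s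
        using e(2) h(2) that by (auto simp: subset_iff less_imp_le)
      have "continuous_on (cball t0 h) (\<lambda>s. norm (x s - y s))"
        by (intro continuous_intros continuous_on_subset[OF cx] continuous_on_subset[OF cy])
          (use sub in auto)
      \<comment> \<open>The largest distance \<open>D\<close> between the two solutions near
        \<open>t0\<close> controls itself: they agree at \<open>t0\<close> and separate with speed
        at most \<open>L * D\<close>, so \<open>D \<le> L * D * h\<close>. As
        \<open>L * h < 1\<close>, this forces \<open>D = 0\<close>.\<close>
      then obtain t1 where t1: "t1 \<in> cball t0 h"
        "\<And>s. s \<in> cball t0 h \<Longrightarrow> norm (x s - y s) \<le> norm (x t1 - y t1)"
        using continuous_attains_sup[of "cball t0 h" "\<lambda>s. norm (x s - y s)"] h by force
      define D where "D = norm (x t1 - y t1)"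
      have derD: "((\<lambda>t. x t - y t) has_vector_derivative F (x u) - F (y u)) (at u within cball t0 h)"
        if u: "u \<in> cball t0 h" for u
        using has_vector_derivative_diff[OF dx(1)[OF sub(1)[OF u]] dy(1)[OF sub(1)[OF u]]]
        by (rule has_vector_derivative_at_within)
      have leD: "norm (F (x u) - F (y u)) \<le> L * D" if u: "u \<in> cball t0 h" for u
      proof -
        have "norm (F (x u) - F (y u)) \<le> L * norm (x u - y u)"
          using lipschitz_onD[OF L sub(2,3)[OF u]] by (simp add: dist_norm)
        also have "\<dots> \<le> L * D" unfolding D_def using L0 by (rule mult_left_mono[OF t1(2)[OF u]])
        finally show ?thesis .
      qed
      have "t0 \<in> cball t0 h" using h by simp
      from vector_derivative_bound[OF convex_cball this t1(1) derD leD]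
      have "norm ((x t1 - y t1) - (x t0 - y t0)) \<le> (L * D) * \<bar>t1 - t0\<bar>" .
      also have "\<dots> \<le> (L * D) * h"
        using t1(1) L0 by (intro mult_left_mono) (auto simp: dist_real_def D_def)
      finally have "D \<le> L * D * h" by (simp add: eq D_def)
      then have "D * (1 - L * h) \<le> 0" by (simp add: algebra_simps)
      then have D: "D \<le> 0" using Lh by (simp add: mult_le_0_iff)
      have "s \<in> S" if s: "s \<in> ball t0 h" for s
      proof -
        have s': "s \<in> cball t0 h" using s by simp
        have "norm (x s - y s) \<le> 0"
          using order_trans[OF t1(2)[OF s'] D[unfolded D_def]] .
        then show ?thesis using sub(1)[OF s'] by (simp add: S_def)
      qed
      then have "ball t0 h \<subseteq> S" by blast
      with h show ?thesis by blast
    qed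
    then have "open S" using open_contains_ball by blast
    then show ?thesis by (simp add: open_subset S_def)
  qed
  ultimately have "S = {} \<or> S = J" using J(2) connected_clopen by blast
  moreover have "0 \<in> S" using J x y by (auto simp: S_def is_solution_def)
  ultimately show ?thesis using t by (auto simp: S_def J_def)
qed

text \<open>Uniqueness makes the definite description in \<open>flow\<close> proper, so that its
  values can be read off from any solution.\<close>

lemma flow_eq_solution:
  assumes "open \<Omega>" "C1_on \<Omega> F" "is_solution F \<Omega> z J x" "t \<in> J"
  shows "flow F \<Omega> t z = x t"
  unfolding flow_def
proof (rule the_equality)
  show "\<exists>J y. is_solution F \<Omega> z J y \<and> t \<in> J \<and> y t = x t" using assms by blast
qed (use solution_unique assms in blast)

section \<open>The action of a reversibility on the vector field\<close>

lemma reversibility_conjugates_field: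
  assumes \<Omega>: "open \<Omega>" "C1_on \<Omega> F" and \<sigma>: "is_reversibility F \<Omega> \<sigma>" and w: "w \<in> \<Omega>"
    and d\<sigma>: "(\<sigma> has_derivative D) (at w)"
  shows "F (\<sigma> w) = - D (F w)"
proof -
  have "\<sigma> w \<in> \<Omega>"
    using \<sigma> w unfolding is_reversibility_def is_involution_def C1_diffeo_onto_itself_def
    by (auto dest: bij_betw_apply)
  then obtain J2 y where y: "is_solution F \<Omega> (\<sigma> w) J2 y" using ex_solution \<Omega> by blast
  obtain J1 x where x: "is_solution F \<Omega> w J1 x" using ex_solution \<Omega> w by blast
  \<comment> \<open>A neighbourhood of 0 consisting of times \<open>t\<close> at which both sides of
    the reversibility relation are defined: the solution from \<open>\<sigma> w\<close> at
    \<open>t\<close>, the solution from \<open>w\<close> at \<open>- t\<close>.\<close>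
  define J where "J = J2 \<inter> uminus -` J1"
  have J: "open J" "0 \<in> J"
    using x y unfolding J_def is_solution_def
    by (auto intro!: open_Int open_vimage continuous_intros)
  have eq: "\<sigma> (x (- t)) = y t" if "t \<in> J" for t
  proof -
    have t: "t \<in> J2" "- t \<in> J1" using that by (auto simp: J_def)
    then have "t \<in> flow_dom F \<Omega> (\<sigma> w)" "- t \<in> flow_dom F \<Omega> w"
      using x y by (auto simp: flow_dom_def)
    then have "flow F \<Omega> t (\<sigma> w) = \<sigma> (flow F \<Omega> (- t) w)"
      using \<sigma> w unfolding is_reversibility_def by blast
    then show ?thesis
      using flow_eq_solution[OF \<Omega> y t(1)] flow_eq_solution[OF \<Omega> x t(2)] by simp
  qed
  have x0: "x 0 = w" "(x has_vector_derivative F w) (at 0)"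
    and y0: "y 0 = \<sigma> w" "(y has_vector_derivative F (\<sigma> w)) (at 0)"
    using x y by (auto simp: is_solution_def)
  have "(uminus has_vector_derivative - 1) (at (0 :: real))"
    using has_vector_derivative_minus[OF has_vector_derivative_id] by simp
  then have "((\<lambda>t. x (- t)) has_vector_derivative - F w) (at 0)"
    using vector_diff_chain_at[of uminus "-1" 0 x "F w"] x0 by (simp add: o_def)
  then have "((\<lambda>t. \<sigma> (x (- t))) has_vector_derivative D (- F w)) (at 0)"
    using vector_derivative_diff_chain_within[of "\<lambda>t. x (- t)" "- F w" 0 UNIV \<sigma> D] x0
      has_derivative_at_withinI[OF d\<sigma>]
    by (simp add: o_def)
  \<comment> \<open>Both sides of the relation agree near 0, so their velocities there agree as
    well.\<close>
  then have "(y has_vector_derivative D (- F w)) (at 0)"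
    by (rule has_vector_derivative_transform_within_open[OF _ J eq])
  then have "F (\<sigma> w) = D (- F w)"
    by (rule vector_derivative_unique_at[OF y0(2)])
  also have "\<dots> = - D (F w)"
    using d\<sigma> by (simp add: has_derivative_bounded_linear linear_simps)
  finally show ?thesis .
qed

subsection \<open>The divergence of a continuously differentiable field\<close>

text \<open>The divergence is the trace of the total derivative, whose diagonal entries are the
  partial derivatives. This form shows its continuity and fits the product rule.\<close>

lemma divergence_eq:
  assumes "(F has_derivative F') (at z)"
  shows "divergence F z = (\<Sum>i\<in>UNIV. F' (axis i 1) $ i)"
  unfolding divergence_def
proof (rule sum.cong[OF refl], rule DERIV_imp_deriv)
  fix i
  have "((\<lambda>s :: real. z + s *\<^sub>R axis i 1) has_derivative (\<lambda>s. s *\<^sub>R axis i 1)) (at 0)"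
    by (auto intro!: derivative_eq_intros)
  moreover have "(F has_derivative F') (at (z + 0 *\<^sub>R axis i 1))" using assms by simp
  ultimately have "((\<lambda>s. F (z + s *\<^sub>R axis i 1)) has_derivative (\<lambda>s. F' (s *\<^sub>R axis i 1))) (at 0)"
    by (rule has_derivative_compose)
  then have "((\<lambda>s. F (z + s *\<^sub>R axis i 1) $ i) has_derivative (\<lambda>s. F' (s *\<^sub>R axis i 1) $ i)) (at 0)"
    by (rule bounded_linear.has_derivative[OF bounded_linear_vec_nth])
  moreover have "F' (s *\<^sub>R axis i 1) $ i = F' (axis i 1) $ i * s" for s
    using has_derivative_bounded_linear[OF assms] by (simp add: linear_simps)
  ultimately show "((\<lambda>s. F (z + s *\<^sub>R axis i 1) $ i) has_real_derivative F' (axis i 1) $ i) (at 0)"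
    by (simp add: has_field_derivative_def)
qed

lemma continuous_on_divergence:
  assumes "C1_on \<Omega> F"
  shows "continuous_on \<Omega> (divergence F)"
proof -
  obtain F' where F': "\<And>z. z \<in> \<Omega> \<Longrightarrow> (F has_derivative blinfun_apply (F' z)) (at z)"
    and cF': "continuous_on \<Omega> F'"
    using assms C1_on_def by metis
  have "continuous_on \<Omega> (\<lambda>z. \<Sum>i\<in>UNIV. F' z (axis i 1) $ i)"
    by (intro continuous_intros cF')
  then show ?thesis
    by (rule continuous_on_eq) (simp add: divergence_eq[OF F'])
qed

lemma C1_on_imp_continuous_on:
  assumes "C1_on \<Omega> F"
  shows "continuous_on \<Omega> F"
proof -
  obtain F' where F': "\<And>z. z \<in> \<Omega> \<Longrightarrow> (F has_derivative blinfun_apply (F' z)) (at z)"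
    using assms C1_on_def by metis
  show ?thesis
    by (intro continuous_at_imp_continuous_on ballI has_derivative_continuous[OF F'])
qed

subsection \<open>The divergence theorem for compactly supported fields\<close>

lemma has_derivative_eq_0_outside_support:
  fixes g :: "'a::real_normed_vector \<Rightarrow> 'b::real_normed_vector"
  assumes "open S" "x \<in> S" "\<And>y. y \<in> S \<Longrightarrow> g y = 0" "(g has_derivative g') (at x)"
  shows "g' v = 0"
proof -
  have "((\<lambda>_. 0) has_derivative g') (at x)"
    by (rule has_derivative_transform_within_open[OF assms(4,1,2)]) (use assms(3) in simp)
  then have "g' = (\<lambda>_. 0)"
    using has_derivative_const by (rule has_derivative_unique)
  then show ?thesis by simp
qed

text \<open>By translation invariance every difference quotient of \<open>g\<close> has integral 0, and
  the difference quotients are dominated by an integrable function.\<close>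

lemma integral_directional_derivative_eq_0:
  fixes g :: "'a::euclidean_space \<Rightarrow> real"
  assumes K: "compact K" and supp: "\<And>x. x \<notin> K \<Longrightarrow> g x = 0"
    and dg: "\<And>x. (g has_derivative g' x) (at x)"
    and cg': "continuous_on UNIV (\<lambda>x. g' x v)"
  shows "integrable lborel (\<lambda>x. g' x v)" and "(\<integral>x. g' x v \<partial>lborel) = 0"
proof -
  have oK: "open (- K)" using K by (simp add: compact_imp_closed open_Compl)
  have supp': "g' x v = 0" if "x \<notin> K" for x
    by (rule has_derivative_eq_0_outside_support[OF oK _ _ dg]) (use that supp in auto)
  have cg: "continuous_on UNIV g"
    by (intro continuous_at_imp_continuous_on ballI has_derivative_continuous[OF dg])
  have "integrable lborel (\<lambda>x. indicator K x *\<^sub>R g x)" "integrable lborel (\<lambda>x. indicator K x *\<^sub>R g' x v)"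
    using borel_integrable_compact[OF K] cg cg' continuous_on_subset by (metis subset_UNIV)+
  moreover have "(\<lambda>x. indicator K x *\<^sub>R g x) = g" "(\<lambda>x. indicator K x *\<^sub>R g' x v) = (\<lambda>x. g' x v)"
    using supp supp' by (auto simp: fun_eq_iff indicator_def)
  ultimately have ig: "integrable lborel g" and ig': "integrable lborel (\<lambda>x. g' x v)" by simp_all
  show "integrable lborel (\<lambda>x. g' x v)" by (rule ig')
  have mg[measurable]: "g \<in> borel_measurable borel" by (rule borel_measurable_continuous_onI[OF cg])
  have mg'[measurable]: "(\<lambda>x. g' x v) \<in> borel_measurable borel"
    by (rule borel_measurable_continuous_onI[OF cg'])
  have "compact ((\<lambda>x. g' x v) ` K)"
    by (rule compact_continuous_image[OF continuous_on_subset[OF cg'] K]) simp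
  then obtain B0 where B0: "\<forall>y\<in>(\<lambda>x. g' x v) ` K. norm y \<le> B0"
    using compact_imp_bounded bounded_iff by metis
  \<comment> \<open>\<open>B0\<close> is a bound on \<open>K\<close> only and may be negative if
    \<open>K\<close> is empty; the maximum with 0 also covers the points outside \<open>K\<close>,
    where the derivative vanishes.\<close>
  define B where "B = max 0 B0"
  have B: "norm (g' x v) \<le> B" for x
    using B0 supp'[of x] by (cases "x \<in> K") (auto simp: B_def le_max_iff_disj)
  obtain R where R: "\<forall>x\<in>K. norm x \<le> R"
    using compact_imp_bounded[OF K] bounded_iff by metis
  \<comment> \<open>Since \<open>h n \<le> 1\<close>, this ball contains \<open>K\<close> and all
    its translates by \<open>- h n *\<^sub>R v\<close>. Hence every difference quotient vanishes
    outside it, while inside the mean value inequality bounds it by \<open>B\<close>.\<close>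
  define K' where "K' = cball (0 :: 'a) (R + norm v)"
  define h where "h n = inverse (real (Suc n))" for n
  have h: "0 < h n" "h n \<le> 1" for n by (auto simp: h_def field_simps)
  define q where "q n x = (g (h n *\<^sub>R v + x) - g x) / h n" for n x
  have line: "((\<lambda>t. g (t *\<^sub>R v + x)) has_real_derivative g' (t *\<^sub>R v + x) v) (at t)" for x t
  proof -
    have "((\<lambda>t. t *\<^sub>R v + x) has_derivative (\<lambda>t. t *\<^sub>R v)) (at t)"
      by (auto intro!: derivative_eq_intros)
    from has_derivative_compose[OF this dg]
    have "((\<lambda>t. g (t *\<^sub>R v + x)) has_derivative (\<lambda>s. g' (t *\<^sub>R v + x) (s *\<^sub>R v))) (at t)" .
    moreover have "g' y (s *\<^sub>R v) = g' y v * s" for y s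
      using has_derivative_bounded_linear[OF dg[of y]] by (simp add: linear_simps)
    ultimately show ?thesis by (simp add: has_field_derivative_def)
  qed
  have lim: "(\<lambda>n. q n x) \<longlonglongrightarrow> g' x v" for x
  proof -
    have "((\<lambda>t. (g (t *\<^sub>R v + x) - g x) / t) \<longlongrightarrow> g' x v) (at 0)"
      using line[of x 0] by (simp add: DERIV_def)
    moreover have "filterlim h (at 0) sequentially"
      unfolding h_def
      by (rule filterlim_atI[OF LIMSEQ_inverse_real_of_nat]) simp
    ultimately show ?thesis
      unfolding q_def by (rule filterlim_compose)
  qed
  have dom: "norm (q n x) \<le> indicator K' x *\<^sub>R B" for n x
  proof (cases "x \<in> K'")
    case False
    have "norm (h n *\<^sub>R v) \<le> norm v"
      using h[of n] by (simp add: mult_left_le_one_le)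
    moreover have "norm x \<le> norm (h n *\<^sub>R v + x) + norm (h n *\<^sub>R v)"
      using norm_triangle_ineq4[of "h n *\<^sub>R v + x" "h n *\<^sub>R v"] by simp
    moreover have "norm x > R + norm v" using False by (simp add: K'_def)
    ultimately have "norm (h n *\<^sub>R v + x) > R" "norm x > R"
      using norm_ge_zero[of v] by linarith+
    then have "x \<notin> K" "h n *\<^sub>R v + x \<notin> K" using R by fastforce+
    then show ?thesis using False supp by (simp add: q_def)
  next
    case True
    have "norm (g (h n *\<^sub>R v + x) - g (0 *\<^sub>R v + x)) \<le> B * \<bar>h n - 0\<bar>"
      by (rule vector_derivative_bound[of "{0..h n}" 0 "h n" "\<lambda>t. g (t *\<^sub>R v + x)" "\<lambda>t. g' (t *\<^sub>R v + x) v"])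
        (use h[of n] B line in \<open>auto intro!: DERIV_subset[OF line]
          simp: has_real_derivative_iff_has_vector_derivative[symmetric]\<close>)
    then show ?thesis
      using True h[of n] by (simp add: q_def field_simps)
  qed
  have iq: "(\<integral>x. q n x \<partial>lborel) = 0" for n
  proof -
    have "integrable lborel (\<lambda>x. g (h n *\<^sub>R v + x))"
      "(\<integral>x. g (h n *\<^sub>R v + x) \<partial>lborel) = (\<integral>x. g x \<partial>lborel)"
      using ig integrable_distr_eq[of "(+) (h n *\<^sub>R v)" lborel borel g]
        integral_distr[of "(+) (h n *\<^sub>R v)" lborel borel g] lborel_distr_plus[of "h n *\<^sub>R v"]
      by simp_all
    then show ?thesis unfolding q_def using ig by simp
  qed
  have "(\<lambda>n. \<integral>x. q n x \<partial>lborel) \<longlonglongrightarrow> (\<integral>x. g' x v \<partial>lborel)"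
  proof (rule integral_dominated_convergence[where w = "\<lambda>x. indicator K' x *\<^sub>R B"])
    show "integrable lborel (\<lambda>x. indicator K' x *\<^sub>R B)"
      by (rule borel_integrable_compact) (auto simp: K'_def)
    show "q n \<in> borel_measurable lborel" for n
      unfolding q_def by measurable
  qed (use lim dom in auto)
  then show "(\<integral>x. g' x v \<partial>lborel) = 0"
    unfolding iq using LIMSEQ_unique[OF tendsto_const] by metis
qed

text \<open>The integrand is the divergence of the field \<open>F\<close> scaled by
  \<open>\<eta>\<close>, so each of its summands is a directional derivative of a compactly
  supported function. Smoothness of \<open>\<eta>\<close> is asked for on \<open>\<Omega>\<close>
  only, so that a bump function composed with \<open>\<sigma>\<close> is admissible.\<close>

lemma integral_divergence_scaled_field_eq_0:
  fixes F :: "real ^ 'n \<Rightarrow> real ^ 'n" and \<eta> :: "real ^ 'n \<Rightarrow> real"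
  assumes \<Omega>: "open \<Omega>" and K: "compact K" "K \<subseteq> \<Omega>" and supp: "\<And>x. x \<in> \<Omega> \<Longrightarrow> x \<notin> K \<Longrightarrow> \<eta> x = 0"
    and d\<eta>: "\<And>x. x \<in> \<Omega> \<Longrightarrow> (\<eta> has_derivative \<eta>' x) (at x)"
    and c\<eta>': "\<And>v. continuous_on \<Omega> (\<lambda>x. \<eta>' x v)"
    and F: "C1_on \<Omega> F"
  shows "set_integrable lborel \<Omega> (\<lambda>x. \<eta>' x (F x) + \<eta> x * divergence F x)"
    and "(LINT x:\<Omega>|lborel. \<eta>' x (F x) + \<eta> x * divergence F x) = 0"
proof -
  obtain F' where dF: "\<And>x. x \<in> \<Omega> \<Longrightarrow> (F has_derivative blinfun_apply (F' x)) (at x)"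
    and cF': "continuous_on \<Omega> F'"
    using F C1_on_def by metis
  \<comment> \<open>Extension by zero keeps the components of the scaled field continuously
    differentiable: \<open>\<Omega>\<close> and \<open>- K\<close> are open and cover the space, and
    on \<open>- K\<close> the extension is zero.\<close>
  define G where "G i x = (if x \<in> \<Omega> then \<eta> x * F x $ i else 0)" for i x
  define G' where "G' i x v = (if x \<in> \<Omega> then \<eta>' x v * F x $ i + \<eta> x * F' x v $ i else 0)" for i x v
  have oK: "open (- K)" using K by (simp add: compact_imp_closed open_Compl)
  have G0: "G i x = 0" if "x \<notin> K" for i x using that supp by (simp add: G_def)
  have dG: "(G i has_derivative G' i x) (at x)" for i x
  proof (cases "x \<in> \<Omega>")
    case True
    have "((\<lambda>x. \<eta> x * F x $ i) has_derivative (\<lambda>v. \<eta> x * F' x v $ i + \<eta>' x v * F x $ i)) (at x)"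
      by (intro has_derivative_mult d\<eta> True bounded_linear.has_derivative[OF bounded_linear_vec_nth] dF)
    then have "(G i has_derivative (\<lambda>v. \<eta> x * F' x v $ i + \<eta>' x v * F x $ i)) (at x)"
      by (rule has_derivative_transform_within_open[OF _ \<Omega> True]) (simp add: G_def)
    moreover have "(\<lambda>v. \<eta> x * F' x v $ i + \<eta>' x v * F x $ i) = G' i x"
      using True by (simp add: G'_def fun_eq_iff)
    ultimately show ?thesis by simp
  next
    case False
    have "((\<lambda>_. 0) has_derivative (\<lambda>_. 0 :: real)) (at x)" by (rule has_derivative_const)
    then have "(G i has_derivative (\<lambda>_. 0)) (at x)"
      by (rule has_derivative_transform_within_open[OF _ oK]) (use False K G0 in auto)
    moreover have "(\<lambda>_. 0) = G' i x"
      using False by (simp add: G'_def fun_eq_iff)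
    ultimately show ?thesis by simp
  qed
  have cG': "continuous_on UNIV (\<lambda>x. G' i x v)" for i v
  proof -
    have c\<eta>: "continuous_on \<Omega> \<eta>" and cF: "continuous_on \<Omega> F"
      by (intro continuous_at_imp_continuous_on ballI has_derivative_continuous[OF d\<eta>],
          simp, rule C1_on_imp_continuous_on[OF F])
    have "continuous_on \<Omega> (\<lambda>x. \<eta>' x v * F x $ i + \<eta> x * F' x v $ i)"
      by (intro continuous_intros c\<eta>' cF c\<eta> cF')
    then have "continuous_on \<Omega> (\<lambda>x. G' i x v)"
      by (rule continuous_on_eq) (simp add: G'_def)
    moreover have "G' i x v = 0" if "x \<in> - K" for x
      by (rule has_derivative_eq_0_outside_support[OF oK that _ dG]) (simp add: G0)
    then have "continuous_on (- K) (\<lambda>x. G' i x v)"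
      by (intro continuous_on_eq[OF continuous_on_const[of "- K" 0]]) simp
    ultimately have "continuous_on (\<Omega> \<union> - K) (\<lambda>x. G' i x v)"
      using \<Omega> oK by (intro continuous_on_open_Un)
    moreover have "\<Omega> \<union> - K = UNIV" using K by blast
    ultimately show ?thesis by simp
  qed
  have int: "integrable lborel (\<lambda>x. G' i x (axis i 1))" "(\<integral>x. G' i x (axis i 1) \<partial>lborel) = 0" for i
    using integral_directional_derivative_eq_0[OF K(1) G0 dG cG'] by blast+
  have lin: "\<eta>' x v = (\<Sum>i\<in>UNIV. \<eta>' x (axis i 1) * v $ i)" if "x \<in> \<Omega>" for x v
  proof -
    interpret bounded_linear "\<eta>' x" using d\<eta>[OF that] by (rule has_derivative_bounded_linear)
    have "\<eta>' x (\<Sum>i\<in>UNIV. v $ i *\<^sub>R axis i 1) = (\<Sum>i\<in>UNIV. \<eta>' x (axis i 1) * v $ i)"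
      by (simp add: sum scaleR mult.commute)
    then show ?thesis
      using basis_expansion[of v] by (simp add: scalar_mult_eq_scaleR)
  qed
  have eq: "indicator \<Omega> x *\<^sub>R (\<eta>' x (F x) + \<eta> x * divergence F x)
      = (\<Sum>i\<in>UNIV. G' i x (axis i 1))" for x
  proof (cases "x \<in> \<Omega>")
    case True
    then show ?thesis
      by (simp add: G'_def lin[OF True, of "F x"] divergence_eq[OF dF] sum.distrib sum_distrib_left)
  qed (simp add: G'_def)
  show "set_integrable lborel \<Omega> (\<lambda>x. \<eta>' x (F x) + \<eta> x * divergence F x)"
    unfolding set_integrable_def eq by (intro Bochner_Integration.integrable_sum int)
  show "(LINT x:\<Omega>|lborel. \<eta>' x (F x) + \<eta> x * divergence F x) = 0"
    unfolding set_lebesgue_integral_def eq using int by (simp add: Bochner_Integration.integral_sum)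
qed

subsection \<open>Measure-preserving involutions\<close>

text \<open>The map \<open>\<sigma>\<close> pushes Lebesgue measure on \<open>\<Omega>\<close>
  forward to itself; both claims are then the change of variables for an image measure.\<close>

lemma set_integral_measure_preserving_involution:
  fixes \<sigma> :: "real ^ 'n \<Rightarrow> real ^ 'n" and f :: "real ^ 'n \<Rightarrow> real"
  assumes \<Omega>: "open \<Omega>" and \<sigma>: "continuous_on \<Omega> \<sigma>" "\<And>x. x \<in> \<Omega> \<Longrightarrow> \<sigma> x \<in> \<Omega>" "\<And>x. x \<in> \<Omega> \<Longrightarrow> \<sigma> (\<sigma> x) = x"
    and mp: "measure_preserving_on \<Omega> \<sigma>" and f: "continuous_on \<Omega> f"
  shows "set_integrable lborel \<Omega> (\<lambda>x. f (\<sigma> x)) \<longleftrightarrow> set_integrable lborel \<Omega> f"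
    and "(LINT x:\<Omega>|lborel. f (\<sigma> x)) = (LINT x:\<Omega>|lborel. f x)"
proof -
  define M where "M = restrict_space (lborel :: (real ^ 'n) measure) \<Omega>"
  have spM: "space M = \<Omega>" by (simp add: M_def space_restrict_space)
  have sM: "sets M = sets (restrict_space borel \<Omega>)" by (simp add: M_def sets_restrict_space)
  have "\<sigma> \<in> measurable (restrict_space borel \<Omega>) (restrict_space borel \<Omega>)"
    using \<sigma> by (intro measurable_restrict_space2 borel_measurable_continuous_on_restrict)
      (auto simp: space_restrict_space)
  then have m\<sigma>: "\<sigma> \<in> measurable M M"
    using sM by (simp cong: measurable_cong_sets)
  have "f \<in> borel_measurable (restrict_space borel \<Omega>)"
    using f by (rule borel_measurable_continuous_on_restrict)
  then have mf: "f \<in> borel_measurable M"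
    using sM by (simp cong: measurable_cong_sets)
  have distr: "distr M M \<sigma> = M"
  proof (rule measure_eqI)
    fix A assume "A \<in> sets (distr M M \<sigma>)"
    then have A: "A \<in> sets M" by simp
    then have A': "A \<subseteq> \<Omega>" "A \<in> sets borel"
      using sets.sets_into_space[OF A] \<Omega> unfolding spM sM
      by (auto simp: sets_restrict_space)
    \<comment> \<open>For an involution preimages are images. This links the push-forward, defined
      by preimages, to the hypothesis on the measure of images.\<close>
    have pre: "\<sigma> -` A \<inter> \<Omega> = \<sigma> ` A"
      using A' \<sigma> by (force simp: image_iff)
    have "\<sigma> ` A \<in> sets M"
      using measurable_sets[OF m\<sigma> A] pre spM by simp
    then have B: "\<sigma> ` A \<subseteq> \<Omega>" "\<sigma> ` A \<in> sets borel"
      using sets.sets_into_space[of "\<sigma> ` A" M] \<Omega> unfolding spM sM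
      by (auto simp: sets_restrict_space)
    have "emeasure (distr M M \<sigma>) A = emeasure M (\<sigma> ` A)"
      using emeasure_distr[OF m\<sigma> A] pre spM by simp
    \<comment> \<open>Both \<open>A\<close> and its image are Borel sets, on which Lebesgue measure
      and its completion agree.\<close>
    also have "\<dots> = emeasure lebesgue (\<sigma> ` A)"
      using B \<Omega> by (simp add: M_def emeasure_restrict_space)
    also have "\<dots> = emeasure lebesgue A"
      using mp A' unfolding measure_preserving_on_def by simp
    also have "\<dots> = emeasure M A"
      using A' \<Omega> by (simp add: M_def emeasure_restrict_space)
    finally show "emeasure (distr M M \<sigma>) A = emeasure M A" .
  qed simp
  have \<Omega>': "\<Omega> \<inter> space lborel \<in> sets lborel" using \<Omega> by simp
  show "set_integrable lborel \<Omega> (\<lambda>x. f (\<sigma> x)) \<longleftrightarrow> set_integrable lborel \<Omega> f"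
    unfolding set_integrable_def integrable_restrict_space[OF \<Omega>', symmetric] M_def[symmetric]
    using integrable_distr_eq[OF m\<sigma> mf] distr by simp
  show "(LINT x:\<Omega>|lborel. f (\<sigma> x)) = (LINT x:\<Omega>|lborel. f x)"
    unfolding set_lebesgue_integral_def integral_restrict_space[OF \<Omega>', symmetric] M_def[symmetric]
    using integral_distr[OF m\<sigma> mf] distr by simp
qed

subsection \<open>The divergence changes sign under a measure-preserving reversibility\<close>

text \<open>Squaring the positive part removes its kink at 0, where the difference quotient is at
  most \<open>\<bar>h\<bar>\<close>. This gives an explicit bump function of class
  \<open>C1\<close>.\<close>

lemma has_real_derivative_max_0_square:
  "((\<lambda>u :: real. (max 0 u)\<^sup>2) has_real_derivative 2 * max 0 u) (at u)"
proof (cases u "0 :: real" rule: linorder_cases)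
  case less
  have "((\<lambda>u. 0) has_real_derivative 2 * max 0 u) (at u)" using less by simp
  then show ?thesis
    by (rule has_field_derivative_transform_within_open[of _ _ _ "{..<0}"]) (use less in auto)
next
  case greater
  have "((\<lambda>u. u\<^sup>2) has_real_derivative 2 * max 0 u) (at u)"
    using greater by (auto intro!: derivative_eq_intros)
  then show ?thesis
    by (rule has_field_derivative_transform_within_open[of _ _ _ "{0<..}"]) (use greater in auto)
next
  case equal
  have "(\<lambda>h :: real. (max 0 h)\<^sup>2 / h) \<midarrow>0\<rightarrow> 0"
  proof (rule Lim_null_comparison)
    show "\<forall>\<^sub>F h in at 0. norm ((max 0 h)\<^sup>2 / h) \<le> \<bar>h :: real\<bar>"
      by (rule always_eventually) (auto simp: max_def power2_eq_square)
    show "((\<lambda>h :: real. \<bar>h\<bar>) \<longlongrightarrow> 0) (at 0)"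
      by (rule tendsto_eq_intros | simp)+
  qed
  then show ?thesis using equal by (simp add: DERIV_def)
qed

lemma set_integrable_integral_cong_on:
  fixes f g :: "'a \<Rightarrow> 'b::{banach, second_countable_topology}"
  assumes "\<And>x. x \<in> A \<Longrightarrow> f x = g x"
  shows "set_integrable M A f \<longleftrightarrow> set_integrable M A g"
    and "(LINT x:A|M. f x) = (LINT x:A|M. g x)"
proof -
  have "(\<lambda>x. indicator A x *\<^sub>R f x) = (\<lambda>x. indicator A x *\<^sub>R g x)"
    using assms by (auto simp: fun_eq_iff indicator_def)
  then show "set_integrable M A f \<longleftrightarrow> set_integrable M A g" "(LINT x:A|M. f x) = (LINT x:A|M. g x)"
    by (simp_all add: set_integrable_def set_lebesgue_integral_def)
qed

text \<open>If the sum of the two divergences were nonzero at \<open>p\<close>, it would keep its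
  sign on a small ball around \<open>p\<close>. A bump function supported in that ball then
  contradicts the weak identity.\<close>

lemma divergence_reversibility:
  fixes F \<sigma> :: "real ^ 'n \<Rightarrow> real ^ 'n"
  assumes \<Omega>: "open \<Omega>" and F: "C1_on \<Omega> F" and rev: "is_reversibility F \<Omega> \<sigma>"
    and mp: "measure_preserving_on \<Omega> \<sigma>" and p: "p \<in> \<Omega>"
  shows "divergence F (\<sigma> p) = - divergence F p"
proof (rule ccontr)
  have inv: "is_involution \<Omega> \<sigma>" using rev by (simp add: is_reversibility_def)
  then have "C1_on \<Omega> \<sigma>" by (simp add: is_involution_def C1_diffeo_onto_itself_def)
  then obtain S where S: "\<And>z. z \<in> \<Omega> \<Longrightarrow> (\<sigma> has_derivative blinfun_apply (S z)) (at z)"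
    and cS: "continuous_on \<Omega> S"
    using C1_on_def by metis
  have \<sigma>in: "\<sigma> x \<in> \<Omega>" and \<sigma>\<sigma>: "\<sigma> (\<sigma> x) = x" if "x \<in> \<Omega>" for x
    using inv that by (auto simp: is_involution_def C1_diffeo_onto_itself_def dest: bij_betw_apply)
  have c\<sigma>: "continuous_on \<Omega> \<sigma>"
    by (intro continuous_at_imp_continuous_on ballI has_derivative_continuous[OF S])
  have cF: "continuous_on \<Omega> F"
    using F by (rule C1_on_imp_continuous_on)
  have subst: "set_integrable lborel \<Omega> (\<lambda>x. f (\<sigma> x)) \<longleftrightarrow> set_integrable lborel \<Omega> f"
    "(LINT x:\<Omega>|lborel. f (\<sigma> x)) = (LINT x:\<Omega>|lborel. f x)"
    if "continuous_on \<Omega> f" for f :: "real ^ 'n \<Rightarrow> real"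
    using set_integral_measure_preserving_involution[of \<Omega> \<sigma> f] \<Omega> c\<sigma> \<sigma>in \<sigma>\<sigma> mp that by simp_all
  have conj: "S x (F x) = - F (\<sigma> x)" if "x \<in> \<Omega>" for x
    using reversibility_conjugates_field[OF \<Omega> F rev that S[OF that]] by simp
  define d where "d = divergence F"
  have cd: "continuous_on \<Omega> d" unfolding d_def using F by (rule continuous_on_divergence)
  have cd\<sigma>: "continuous_on \<Omega> (\<lambda>x. d (\<sigma> x))"
    by (rule continuous_on_compose2[OF cd c\<sigma>]) (use \<sigma>in in auto)
  \<comment> \<open>The sign makes \<open>H p\<close> the absolute value of the sum, so that both
    signs are treated at once.\<close>
  define s where "s = sgn (d (\<sigma> p) + d p)"
  define H where "H x = s * (d (\<sigma> x) + d x)" for x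
  assume "divergence F (\<sigma> p) \<noteq> - divergence F p"
  then have "H p > 0" by (auto simp: H_def s_def d_def mult_sgn_abs sgn_if)
  have cH: "continuous_on \<Omega> H"
    unfolding H_def by (intro continuous_intros cd cd\<sigma>)
  have "open (\<Omega> \<inter> H -` {0<..})"
    using \<Omega> cH by (auto intro: continuous_open_preimage)
  then obtain r where r: "0 < r" and rsub: "cball p r \<subseteq> \<Omega> \<inter> H -` {0<..}"
    using open_contains_cball_eq p \<open>H p > 0\<close> by (metis IntI greaterThan_iff vimageI)
  \<comment> \<open>\<open>b\<close> is positive exactly in the open ball, so the square of its
    positive part is a bump function there; \<open>\<eta>'\<close> is its derivative by the chain
    rule.\<close>
  define b where "b x = r\<^sup>2 - (x - p) \<bullet> (x - p)" for x
  define \<eta> where "\<eta> x = (max 0 (b x))\<^sup>2" for x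
  define \<eta>' where "\<eta>' x v = 2 * max 0 (b x) * (- (2 * ((x - p) \<bullet> v)))" for x v
  have b: "b x = r\<^sup>2 - (dist p x)\<^sup>2" for x
    by (simp add: b_def dist_norm norm_minus_commute[of p x] flip: power2_norm_eq_inner)
  have d\<eta>: "(\<eta> has_derivative \<eta>' x) (at x)" for x
  proof -
    have "(b has_derivative (\<lambda>v. - (2 * ((x - p) \<bullet> v)))) (at x)"
      unfolding b_def by (auto intro!: derivative_eq_intros simp: inner_commute)
    then have "((\<lambda>x. (max 0 (b x))\<^sup>2) has_derivative (\<lambda>v. 2 * max 0 (b x) * (- (2 * ((x - p) \<bullet> v))))) (at x)"
      using has_derivative_compose has_real_derivative_max_0_square[unfolded has_field_derivative_def]
      by blast
    moreover have "\<eta> = (\<lambda>x. (max 0 (b x))\<^sup>2)" "\<eta>' x = (\<lambda>v. 2 * max 0 (b x) * (- (2 * ((x - p) \<bullet> v))))"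
      by (auto simp: \<eta>_def \<eta>'_def fun_eq_iff)
    ultimately show ?thesis by simp
  qed
  have c\<eta>: "continuous_on UNIV \<eta>" 
    by (intro continuous_at_imp_continuous_on ballI has_derivative_continuous[OF d\<eta>])
  have supp: "\<eta> x = 0" if "x \<notin> cball p r" for x
    using that r by (simp add: \<eta>_def b power_mono)
  have pos: "\<eta> x > 0" if "x \<in> ball p r" for x
  proof -
    have "(dist p x)\<^sup>2 < r\<^sup>2" using that by (intro power_strict_mono) auto
    then show ?thesis by (simp add: \<eta>_def b)
  qed
  have sub: "cball p r \<subseteq> \<Omega>" using rsub by blast
  let ?P = "\<lambda>x. \<eta>' x (F x) + \<eta> x * d x"
  have cb: "continuous_on A b" for A unfolding b_def by (intro continuous_intros)
  have c\<eta>': "continuous_on A (\<lambda>x. \<eta>' x v)" for A v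
    unfolding \<eta>'_def by (intro continuous_intros cb)
  have cP: "continuous_on \<Omega> ?P"
    unfolding \<eta>'_def by (intro continuous_intros cF cd cb continuous_on_subset[OF c\<eta>]) auto
  have B1: "set_integrable lborel \<Omega> ?P" "(LINT x:\<Omega>|lborel. ?P x) = 0"
    using integral_divergence_scaled_field_eq_0[OF \<Omega> compact_cball sub supp d\<eta> c\<eta>' F]
    by (simp_all add: d_def)
  have B1\<sigma>: "set_integrable lborel \<Omega> (\<lambda>x. ?P (\<sigma> x))" "(LINT x:\<Omega>|lborel. ?P (\<sigma> x)) = 0"
    using subst[OF cP] B1 by simp_all
  \<comment> \<open>\<open>?Q'\<close> is the divergence of \<open>F\<close> scaled by
    \<open>\<eta>\<close> composed with \<open>\<sigma>\<close>. On \<open>\<Omega>\<close> the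
    conjugation relation \<open>conj\<close> replaces \<open>S x (F x)\<close> by
    \<open>- F (\<sigma> x)\<close>, which gives \<open>?Q\<close>.\<close>
  let ?Q = "\<lambda>x. - \<eta>' (\<sigma> x) (F (\<sigma> x)) + \<eta> (\<sigma> x) * d x"
  let ?Q' = "\<lambda>x. \<eta>' (\<sigma> x) (S x (F x)) + \<eta> (\<sigma> x) * d x"
  have K1: "compact (\<sigma> ` cball p r)"
    by (rule compact_continuous_image[OF continuous_on_subset[OF c\<sigma> sub] compact_cball])
  have K2: "\<sigma> ` cball p r \<subseteq> \<Omega>" using sub \<sigma>in by blast
  have K3: "\<eta> (\<sigma> x) = 0" if "x \<in> \<Omega>" "x \<notin> \<sigma> ` cball p r" for x
    using that \<sigma>\<sigma>[OF that(1)] by (metis imageI supp)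
  have K4: "((\<lambda>x. \<eta> (\<sigma> x)) has_derivative (\<lambda>v. \<eta>' (\<sigma> x) (S x v))) (at x)" if "x \<in> \<Omega>" for x
    using S[OF that] d\<eta> by (rule has_derivative_compose)
  have K5: "continuous_on \<Omega> (\<lambda>x. \<eta>' (\<sigma> x) (S x v))" for v
    unfolding \<eta>'_def by (intro continuous_intros c\<sigma> cS continuous_on_compose2[OF cb[of UNIV] c\<sigma>]) auto
  have Q'1: "set_integrable lborel \<Omega> ?Q'"
    unfolding d_def by (rule integral_divergence_scaled_field_eq_0(1)[OF \<Omega> K1 K2 K3 K4 K5 F])
  have Q'2: "(LINT x:\<Omega>|lborel. ?Q' x) = 0"
    unfolding d_def by (rule integral_divergence_scaled_field_eq_0(2)[OF \<Omega> K1 K2 K3 K4 K5 F])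
  have eqQ: "?Q' x = ?Q x" if "x \<in> \<Omega>" for x
    by (simp add: conj[OF that] \<eta>'_def)
  have B2: "set_integrable lborel \<Omega> ?Q" "(LINT x:\<Omega>|lborel. ?Q x) = 0"
    using set_integrable_integral_cong_on[of \<Omega> ?Q' ?Q, OF eqQ] Q'1 Q'2 by simp_all
  let ?R = "\<lambda>x. \<eta> x * H x"
  \<comment> \<open>The terms with \<open>\<eta>'\<close> cancel. What remains is \<open>?R\<close>
    at \<open>\<sigma> x\<close>, because \<open>H\<close> takes the same value at \<open>x\<close>
    and \<open>\<sigma> x\<close>. A further substitution of \<open>\<sigma>\<close> moves the
    integral back to \<open>?R\<close>.\<close>
  have eqR: "s * (?P (\<sigma> x) + ?Q x) = ?R (\<sigma> x)" if "x \<in> \<Omega>" for x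
    using that by (simp add: H_def \<sigma>\<sigma> algebra_simps)
  have cR: "continuous_on \<Omega> ?R"
    by (intro continuous_intros cH continuous_on_subset[OF c\<eta>]) auto
  have "set_integrable lborel \<Omega> (\<lambda>x. s * (?P (\<sigma> x) + ?Q x))"
    "(LINT x:\<Omega>|lborel. s * (?P (\<sigma> x) + ?Q x)) = 0"
    using set_integral_add[OF B1\<sigma>(1) B2(1)] B1\<sigma>(2) B2(2) by simp_all
  then have "set_integrable lborel \<Omega> (\<lambda>x. ?R (\<sigma> x))" "(LINT x:\<Omega>|lborel. ?R (\<sigma> x)) = 0"
    using set_integrable_integral_cong_on[of \<Omega> "\<lambda>x. s * (?P (\<sigma> x) + ?Q x)" "\<lambda>x. ?R (\<sigma> x)", OF eqR]
    by (simp_all only:)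
  then have "set_integrable lborel \<Omega> ?R" "(LINT x:\<Omega>|lborel. ?R x) = 0"
    using subst[OF cR] by simp_all
  moreover have "0 \<le> indicator \<Omega> x *\<^sub>R ?R x" for x
  proof (cases "x \<in> cball p r")
    case True
    then have "H x > 0" using rsub by auto
    then show ?thesis by (simp add: \<eta>_def)
  qed (simp add: supp)
  \<comment> \<open>A nonnegative function with integral 0 vanishes almost everywhere, but this one
    is positive on the open ball, which is not a null set.\<close>
  ultimately have "AE x in lborel. indicator \<Omega> x *\<^sub>R ?R x = 0"
    unfolding set_integrable_def set_lebesgue_integral_def
    by (subst integral_nonneg_eq_0_iff_AE[symmetric]) auto
  then have "AE x in lborel. x \<notin> ball p r"
  proof (rule AE_mp, intro AE_I2 impI notI)
    fix x assume *: "indicator \<Omega> x *\<^sub>R ?R x = 0" and x: "x \<in> ball p r"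
    have "x \<in> \<Omega>" "H x > 0" using x rsub by (auto simp: subset_iff)
    then show False using * pos[OF x] by simp
  qed
  then have "ball p r \<in> null_sets lborel"
    by (subst AE_iff_null_sets) auto
  then have "negligible (ball p r)"
    by (simp add: negligible_iff_null_sets null_sets_completionI)
  then show False
    using open_not_negligible[of "ball p r"] r by simp
qed

section \<open>Zeros of the divergence at fixed points and on arcs of orbits\<close>

theorem theorem1:
  fixes \<Omega> :: "(real ^ 'n) set"
    and F \<sigma> :: "real ^ 'n \<Rightarrow> real ^ 'n"
  assumes "open \<Omega>" and "connected \<Omega>"
    and "C1_on \<Omega> F"
    and "is_reversibility F \<Omega> \<sigma>"
    and "measure_preserving_on \<Omega> \<sigma>"
  shows "(\<forall>z\<in>\<Omega>. \<forall>t\<^sub>z\<in>flow_dom F \<Omega> z.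
            \<sigma> z = flow F \<Omega> t\<^sub>z z \<and> flow F \<Omega> t\<^sub>z z \<noteq> z \<longrightarrow>
            (\<exists>z\<^sub>0\<in>orbit_arc F \<Omega> z t\<^sub>z. z\<^sub>0 \<in> zero_div_set F \<Omega>))
       \<and> (\<forall>z\<in>\<Omega>. \<sigma> z = z \<and> F z \<noteq> 0 \<longrightarrow> z \<in> zero_div_set F \<Omega>)"
proof (intro conjI ballI impI)
  note rev = divergence_reversibility[OF assms(1,3-5)]
  show "z \<in> zero_div_set F \<Omega>" if z: "z \<in> \<Omega>" "\<sigma> z = z \<and> F z \<noteq> 0" for z
    using rev[OF z(1)] z by (simp add: zero_div_set_def)
  fix z T
  assume z: "z \<in> \<Omega>" and T: "T \<in> flow_dom F \<Omega> z"
    and \<sigma>z: "\<sigma> z = flow F \<Omega> T z \<and> flow F \<Omega> T z \<noteq> z"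
  obtain J x where x: "is_solution F \<Omega> z J x" and TJ: "T \<in> J"
    using T by (auto simp: flow_dom_def)
  have J: "is_interval J" "0 \<in> J" "x 0 = z"
    and dx: "\<And>t. t \<in> J \<Longrightarrow> x t \<in> \<Omega>" "\<And>t. t \<in> J \<Longrightarrow> (x has_vector_derivative F (x t)) (at t)"
    using x by (auto simp: is_solution_def)
  \<comment> \<open>The unordered segment treats positive and negative \<open>T\<close>
    alike.\<close>
  let ?I = "closed_segment 0 T"
  have I: "?I \<subseteq> J"
    using J TJ by (simp add: closed_segment_subset is_interval_convex)
  have flow: "flow F \<Omega> t z = x t" if "t \<in> J" for t
    using assms(1,3) x that by (rule flow_eq_solution)
  have "continuous_on ?I x"
    by (intro continuous_at_imp_continuous_on ballI has_vector_derivative_continuous[OF dx(2)])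
      (use I in blast)
  then have "continuous_on ?I (\<lambda>t. divergence F (x t))"
    by (rule continuous_on_compose2[OF continuous_on_divergence[OF assms(3)]]) (use dx(1) I in blast)
  then have conn: "connected ((\<lambda>t. divergence F (x t)) ` ?I)" (is "connected ?D")
    by (rule connected_continuous_image) simp
  have D: "divergence F (x 0) \<in> ?D" "divergence F (x T) \<in> ?D"
    by (rule imageI, simp)+
  have "divergence F (x T) = - divergence F (x 0)"
    using rev[OF z] \<sigma>z flow[OF TJ] J(3) by simp
  \<comment> \<open>Opposite values enclose 0 in one order or the other, so the connected set
    \<open>?D\<close> of values along the arc contains 0.\<close>
  then consider "divergence F (x 0) \<le> 0" "0 \<le> divergence F (x T)"
    | "divergence F (x T) \<le> 0" "0 \<le> divergence F (x 0)"
    by linarith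
  then have "0 \<in> ?D"
    using connectedD_interval[OF conn D] connectedD_interval[OF conn D(2,1)] by cases
  then obtain t where t: "t \<in> ?I" "divergence F (x t) = 0" by auto
  with I have "t \<in> J" by blast
  then have "flow F \<Omega> t z \<in> zero_div_set F \<Omega>"
    using t dx(1) flow by (simp add: zero_div_set_def)
  then show "\<exists>z\<^sub>0\<in>orbit_arc F \<Omega> z T. z\<^sub>0 \<in> zero_div_set F \<Omega>"
    using t(1) by (auto simp: orbit_arc_def)
qed

end
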